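(* Let $n$ be a positive integer, let $j\in\{0,1,2,\ldots\}$, let $a$ be a complex parameter, and put $j_0=\lfloor j/2\rfloor$. Fix a choice of sign (all upper signs or all lower signs), and set $\delta_j=j$ when the upper signs are taken and $\delta_j=0$ when the lower signs are taken. Then, with the corresponding choice of signs throughout: (i) if $(2a\pm j)_{2n}\neq 0$, then $${}_2F_1\left[\begin{array}{c} -2n,\ a\\ 2a\pm j\end{array};2\right]=\frac{2^{2n}\left(\tfrac12\right)_n}{(2a\pm j)_{2n}}\sum_{r=0}^{j_0}(-1)^r\binom{j}{2r}(-n)_r\,(a+\delta_j)_{n-r};$$ (ii) if $(2a\pm j)_{2n+1}\neq 0$, then $${}_2F_1\left[\begin{array}{c} -2n-1,\ a\\ 2a\pm j\end{array};2\right]=\pm\frac{2^{2n}\left(\tfrac32\right)_n}{(2a\pm j)_{2n+1}}\sum_{r=0}^{j_0}(-1)^r\binom{j}{2r+1}(-n)_r\,(a+\delta_j)_{n-r}.$$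
   Context: For a complex number $x$ and integer $k\ge 0$, $(x)_k=x(x+1)\cdots(x+k-1)$ (with $(x)_0=1$) is the Pochhammer symbol. For a nonnegative integer $N$, the terminating hypergeometric series is the finite sum $${}_2F_1\left[\begin{array}{c} -N,\ b\\ c\end{array};z\right]=\sum_{k=0}^{N}\frac{(-N)_k(b)_k}{(c)_k}\frac{z^k}{k!},$$ defined whenever $(c)_N\ne 0$. Binomial coefficients $\binom{j}{m}$ with $m>j$ are zero. In the sums over $r$, terms with $r>n$ are understood to be zero (since $(-n)_r=0$ for $r>n$), so that only Pochhammer symbols $(a+\delta_j)_{n-r}$ with $n-r\ge 0$ occur. *)

theory Defs
  imports Complex_Main
begin

(* Terminating series with numerator parameters -N, b and denominator parameter c,
   meaningful when pochhammer c N is nonzero.  The sum is cut off at k = N explicitly, so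
   c may be a negative integer less than or equal to -N. *)
definition hyp2F1_term :: "nat \<Rightarrow> complex \<Rightarrow> complex \<Rightarrow> complex \<Rightarrow> complex" where
  "hyp2F1_term N b c z =
     (\<Sum>k=0..N. pochhammer (- of_nat N) k * pochhammer b k / pochhammer c k * (z ^ k / fact k))"

end

theory Submission
  imports Defs "HOL-Computational_Algebra.Formal_Power_Series"
begin

text \<open>
  Expanding \<open>(c + k)\<^sub>N\<^sub>-\<^sub>k\<close> by Vandermonde's identity shows that \<open>(c)\<^sub>N / N!\<close> times the terminating
  series is the coefficient of \<open>t^N\<close> in \<open>(1 - t)^(b - c) (1 - (1 - z) t)^(-b)\<close>.  For \<open>z = 2\<close>,
  \<open>b = a\<close> and \<open>c = 2a + s j\<close> with \<open>s = 1\<close> or \<open>s = -1\<close>, this function is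
  \<open>(1 + s t)^j (1 - t^2)^(-(a + \<delta>))\<close>, and the two formulas are its even and odd coefficients.
\<close>

section \<open>Vandermonde expansion of the terminating series\<close>

lemma pochhammer_minus_of_nat:
  "pochhammer (- of_nat n :: 'a :: field_char_0) k = (-1) ^ k * fact k * of_nat (n choose k)"
proof -
  have "of_nat (n choose k) = (-1) ^ k * pochhammer (- of_nat n :: 'a) k / fact k"
    by (simp add: binomial_gbinomial gbinomial_pochhammer)
  then show ?thesis
    by simp
qed

text \<open>Clearing \<open>pochhammer c N\<close> leaves the factors
  \<open>(c + k)_(N - k)\<close>. Splitting their base as \<open>(c - b) + (b + k)\<close> lets
  \<open>(b)_k\<close> merge with \<open>(b + k)_(N - k - i)\<close> into
  \<open>(b)_(N - i)\<close>, so that after exchanging the sums only a binomial expansion in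
  \<open>- z\<close> remains over \<open>k\<close>.\<close>

lemma pochhammer_mult_hyp2F1_term:
  assumes "pochhammer c N \<noteq> 0"
  shows "pochhammer c N * hyp2F1_term N b c z =
    (\<Sum>i\<le>N. of_nat (N choose i) * pochhammer (c - b) i * pochhammer b (N - i) * (1 - z) ^ (N - i))"
proof -
  have "pochhammer c N * hyp2F1_term N b c z =
      (\<Sum>k\<le>N. of_nat (N choose k) * (- z) ^ k * pochhammer b k * pochhammer (c + of_nat k) (N - k))"
    unfolding hyp2F1_term_def atLeast0AtMost sum_distrib_left
  proof (rule sum.cong)
    fix k assume "k \<in> {..N}"
    then have k: "pochhammer c N = pochhammer c k * pochhammer (c + of_nat k) (N - k)"
      by (simp add: pochhammer_product)
    with assms have "pochhammer c k \<noteq> 0"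
      by auto
    then show "pochhammer c N * (pochhammer (- of_nat N) k * pochhammer b k / pochhammer c k *
        (z ^ k / fact k)) =
        of_nat (N choose k) * (- z) ^ k * pochhammer b k * pochhammer (c + of_nat k) (N - k)"
      unfolding k pochhammer_minus_of_nat power_minus [of z] by simp
  qed simp
  also have "\<dots> = (\<Sum>k\<le>N. \<Sum>i\<le>N. of_nat (N choose i) * pochhammer (c - b) i * pochhammer b (N - i) *
      (of_nat ((N - i) choose k) * (- z) ^ k))"
  proof (rule sum.cong)
    fix k assume k: "k \<in> {..N}"
    have "pochhammer (c + of_nat k) (N - k) = pochhammer ((c - b) + (b + of_nat k)) (N - k)"
      by simp
    also have "\<dots> = (\<Sum>i\<le>N - k. of_nat ((N - k) choose i) * pochhammer (c - b) i *
        pochhammer (b + of_nat k) (N - k - i))"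
      by (rule pochhammer_binomial_sum)
    \<comment> \<open>The added terms vanish with their binomial coefficients; the index range
      becomes a square, ready for the exchange of sums.\<close>
    also have "\<dots> = (\<Sum>i\<le>N. of_nat ((N - k) choose i) * pochhammer (c - b) i *
        pochhammer (b + of_nat k) (N - k - i))"
      by (rule sum.mono_neutral_left) auto
    finally have *: "pochhammer (c + of_nat k) (N - k) = \<dots>" .
    show "of_nat (N choose k) * (- z) ^ k * pochhammer b k * pochhammer (c + of_nat k) (N - k) =
      (\<Sum>i\<le>N. of_nat (N choose i) * pochhammer (c - b) i * pochhammer b (N - i) *
        (of_nat ((N - i) choose k) * (- z) ^ k))"
      unfolding * sum_distrib_left
    proof (rule sum.cong)
      fix i assume i: "i \<in> {..N}"
      show "of_nat (N choose k) * (- z) ^ k * pochhammer b k *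
          (of_nat ((N - k) choose i) * pochhammer (c - b) i * pochhammer (b + of_nat k) (N - k - i)) =
        of_nat (N choose i) * pochhammer (c - b) i * pochhammer b (N - i) *
          (of_nat ((N - i) choose k) * (- z) ^ k)"
      proof (cases "i + k \<le> N")
        case True
        have "pochhammer b (N - i) = pochhammer b k * pochhammer (b + of_nat k) (N - i - k)"
          using True by (intro pochhammer_product) simp
        moreover have "N - i - k = N - k - i" by simp
        \<comment> \<open>Both sides are the trinomial coefficient
          \<open>N! / (i! k! (N - i - k)!)\<close>.\<close>
        moreover have "of_nat (N choose k) * of_nat ((N - k) choose i) =
            (of_nat (N choose i) * of_nat ((N - i) choose k) :: complex)"
          using True \<open>N - i - k = N - k - i\<close> by (simp add: binomial_fact)
        ultimately show ?thesis by (simp add: mult_ac)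
      \<comment> \<open>For \<open>i + k > N\<close> both \<open>(N - k) choose i\<close> and
        \<open>(N - i) choose k\<close> are zero.\<close>
      qed (use i k in \<open>simp add: binomial_eq_0\<close>)
    qed simp
  qed simp
  also have "\<dots> = (\<Sum>i\<le>N. of_nat (N choose i) * pochhammer (c - b) i * pochhammer b (N - i) *
      (\<Sum>k\<le>N. of_nat ((N - i) choose k) * (- z) ^ k))"
    by (subst sum.swap) (simp add: sum_distrib_left)
  also have "\<dots> = (\<Sum>i\<le>N. of_nat (N choose i) * pochhammer (c - b) i * pochhammer b (N - i) *
      (1 - z) ^ (N - i))"
  proof (rule sum.cong)
    fix i assume "i \<in> {..N}"
    have "(1 - z) ^ (N - i) = (- z + 1) ^ (N - i)" by simp
    also have "\<dots> = (\<Sum>k\<le>N - i. of_nat ((N - i) choose k) * (- z) ^ k)"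
      by (subst binomial_ring) simp
    also have "\<dots> = (\<Sum>k\<le>N. of_nat ((N - i) choose k) * (- z) ^ k)"
      by (rule sum.mono_neutral_left) auto
    finally show "of_nat (N choose i) * pochhammer (c - b) i * pochhammer b (N - i) *
        (\<Sum>k\<le>N. of_nat ((N - i) choose k) * (- z) ^ k) =
        of_nat (N choose i) * pochhammer (c - b) i * pochhammer b (N - i) * (1 - z) ^ (N - i)"
      by simp
  qed simp
  finally show ?thesis .
qed

text \<open>The power series \<open>(1 - x t)^(-c)\<close>.\<close>

definition fps_pochhammer :: "'a::field_char_0 \<Rightarrow> 'a \<Rightarrow> 'a fps" where
  "fps_pochhammer c x = Abs_fps (\<lambda>n. pochhammer c n * x ^ n / fact n)"

lemma fps_nth_pochhammer [simp]:
  "fps_nth (fps_pochhammer c x) n = pochhammer c n * x ^ n / fact n"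
  by (simp add: fps_pochhammer_def)

section \<open>Generating function, and functional equations of the binomial series\<close>

lemma pochhammer_mult_hyp2F1_term_eq_nth:
  assumes "pochhammer c N \<noteq> 0"
  shows "pochhammer c N * hyp2F1_term N b c z =
    fact N * fps_nth (fps_pochhammer (c - b) 1 * fps_pochhammer b (1 - z)) N"
  unfolding pochhammer_mult_hyp2F1_term[OF assms] fps_mult_nth sum_distrib_left atLeast0AtMost
  by (rule sum.cong) (auto simp: binomial_fact field_simps)

text \<open>Coefficientwise this is \<open>(c)_(m+1) = (c+1)_(m+1) - (m+1) (c+1)_m\<close>, where
  \<open>(c+1)_m\<close> is a common factor.\<close>

lemma fps_pochhammer_shift:
  "(1 - fps_const x * fps_X) * fps_pochhammer (c + 1) x = fps_pochhammer c x"
proof (rule fps_ext)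
  fix n
  show "fps_nth ((1 - fps_const x * fps_X) * fps_pochhammer (c + 1) x) n =
      fps_nth (fps_pochhammer c x) n"
  proof (cases n)
    case (Suc m)
    have "pochhammer (c + 1) (Suc m) - of_nat (Suc m) * pochhammer (c + 1) m =
        c * pochhammer (c + 1) m"
      by (simp add: pochhammer_rec' algebra_simps)
    then have "pochhammer c (Suc m) =
        pochhammer (c + 1) (Suc m) - of_nat (Suc m) * pochhammer (c + 1) m"
      by (simp add: pochhammer_rec)
    then show ?thesis
      by (simp add: Suc left_diff_distrib mult.assoc divide_simps del: of_nat_Suc)
  qed (simp add: left_diff_distrib mult.assoc)
qed

lemma fps_pochhammer_shift_power:
  "(1 - fps_const x * fps_X) ^ j * fps_pochhammer (c + of_nat j) x = fps_pochhammer c x"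
proof (induction j)
  case (Suc j)
  have "(1 - fps_const x * fps_X) ^ Suc j * fps_pochhammer (c + of_nat (Suc j)) x =
      (1 - fps_const x * fps_X) ^ j *
      ((1 - fps_const x * fps_X) * fps_pochhammer ((c + of_nat j) + 1) x)"
    by (simp add: mult_ac add_ac)
  then show ?case
    by (simp only: fps_pochhammer_shift Suc.IH)
qed simp

text \<open>The differential equation of \<open>(1 - x t)^(-c)\<close>, equivalent to the recurrence
  \<open>(c)_(n+1) = (c + n) (c)_n\<close>.\<close>

lemma fps_pochhammer_deriv:
  "(1 - fps_const x * fps_X) * fps_deriv (fps_pochhammer c x) =
    fps_const (c * x) * fps_pochhammer c x"
proof (rule fps_ext)
  fix n
  show "fps_nth ((1 - fps_const x * fps_X) * fps_deriv (fps_pochhammer c x)) n =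
    fps_nth (fps_const (c * x) * fps_pochhammer c x) n"
    by (cases n) (simp_all add: left_diff_distrib mult.assoc pochhammer_rec' divide_simps
        del: of_nat_Suc, simp_all add: algebra_simps)
qed

text \<open>The product is \<open>(1 - t^2)^(-c)\<close>. Instead of evaluating an alternating
  convolution, the two first-order equations are combined into
  \<open>(1 - t^2) R' = 2 c t R\<close>, whose two-step recurrence separates even from odd
  coefficients.\<close>

lemma fps_pochhammer_one_mult_minus_one:
  "fps_nth (fps_pochhammer c 1 * fps_pochhammer c (-1)) (2 * m) = pochhammer c m / fact m"
  "fps_nth (fps_pochhammer c 1 * fps_pochhammer c (-1)) (2 * m + 1) = 0"
proof -
  define P where "P = fps_pochhammer c 1"
  define M where "M = fps_pochhammer c (-1)"
  have P: "(1 - fps_X) * fps_deriv P = fps_const c * P"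
    using fps_pochhammer_deriv[of 1 c] by (simp add: P_def)
  have M: "(1 + fps_X) * fps_deriv M = - (fps_const c * M)"
    using fps_pochhammer_deriv[of "-1" c] by (simp add: M_def flip: fps_const_neg)
  have "(1 - fps_X ^ 2) * fps_deriv (P * M) =
      (1 + fps_X) * ((1 - fps_X) * fps_deriv P) * M + (1 - fps_X) * P * ((1 + fps_X) * fps_deriv M)"
    by (simp add: algebra_simps power2_eq_square)
  also have "\<dots> = fps_const (2 * c) * (fps_X * (P * M))"
    unfolding P M by (simp add: algebra_simps flip: fps_const_mult)
      (simp add: fps_numeral_fps_const mult_ac flip: mult_2)
  finally have "(1 - fps_X ^ 2) * fps_deriv (P * M) = fps_const (2 * c) * (fps_X * (P * M))" .
  moreover define R where "R = P * M"
  ultimately have "(1 - fps_X ^ 2) * fps_deriv R = fps_const (2 * c) * (fps_X * R)"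
    by simp
  then have ode: "fps_deriv R = fps_X ^ 2 * fps_deriv R + fps_const (2 * c) * (fps_X * R)"
    by (simp only: left_diff_distrib diff_eq_eq mult_1 add.commute)
  \<comment> \<open>The right-hand side of \<open>ode\<close> is divisible by \<open>t\<close>, so
    the constant term of \<open>R'\<close> is zero.\<close>
  have one: "fps_nth R 1 = 0"
    using arg_cong[OF ode, of "\<lambda>f. fps_nth f 0"] by (simp add: fps_X_power_mult_nth)
  \<comment> \<open>The term \<open>t^2 R'\<close> contributes \<open>n R_n\<close> at degree
    \<open>n + 1\<close>; for \<open>n = 0\<close> the degree is below 2 and the contribution is
    zero, hence the case split.\<close>
  have rec: "of_nat (n + 2) * fps_nth R (n + 2) = (of_nat n + 2 * c) * fps_nth R n" for n
    using arg_cong[OF ode, of "\<lambda>f. fps_nth f (n + 1)"]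
    by (cases n) (simp_all add: fps_X_power_mult_nth fps_X_power_mult_right_nth algebra_simps)
  have "fps_nth R (2 * m) = pochhammer c m / fact m"
  proof (induction m)
    case 0
    show ?case by (simp add: R_def P_def M_def)
  next
    case (Suc m)
    have "2 * (of_nat (Suc m) * fps_nth R (2 * Suc m)) =
        2 * ((c + of_nat m) * (pochhammer c m / fact m))"
      using rec[of "2 * m"] unfolding Suc by (simp add: algebra_simps add_divide_distrib)
    then have "of_nat (Suc m) * fps_nth R (2 * Suc m) = (c + of_nat m) * (pochhammer c m / fact m)"
      by (simp only: mult_left_cancel[OF zero_neq_numeral[symmetric]])
    then show ?case
      by (simp add: pochhammer_rec' field_simps del: of_nat_Suc)
  qed
  moreover have "fps_nth R (2 * m + 1) = 0"
  proof (induction m)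
    case 0
    show ?case using one by simp
  next
    case (Suc m)
    have "of_nat (2 * m + 3) * fps_nth R (2 * Suc m + 1) = 0"
      using rec[of "2 * m + 1"] Suc by (simp add: eval_nat_numeral)
    then show ?case
      by (metis mult_eq_0_iff of_nat_eq_0_iff add_is_0 zero_neq_numeral)
  qed
  ultimately show
    "fps_nth (fps_pochhammer c 1 * fps_pochhammer c (-1)) (2 * m) = pochhammer c m / fact m"
    "fps_nth (fps_pochhammer c 1 * fps_pochhammer c (-1)) (2 * m + 1) = 0"
    unfolding R_def P_def M_def by blast+
qed

section \<open>Tools for reading off even and odd coefficients\<close>

lemma fps_nth_one_plus_const_mult_X_power:
  "fps_nth ((1 + fps_const (s :: 'a :: comm_ring_1) * fps_X) ^ j) k = of_nat (j choose k) * s ^ k"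
proof -
  have "(1 + fps_const s * fps_X) ^ j =
      (\<Sum>i\<le>j. fps_const (of_nat (j choose i) * s ^ i) * fps_X ^ i)"
    by (subst add.commute, subst binomial_ring)
      (simp add: power_mult_distrib mult.assoc flip: fps_of_nat fps_const_mult)
  then show ?thesis
    by (auto simp: fps_sum_nth if_distrib binomial_eq_0 cong: if_cong)
qed

text \<open>Odd counterpart of \<open>fact_double\<close>. Peeling \<open>(1/2)_(n+1)\<close> from
  its first and from its last factor gives \<open>(3/2)_n = (2n + 1) (1/2)_n\<close>.\<close>

lemma fact_double_plus_one:
  "fact (2 * n + 1) = (2 ^ (2 * n) * pochhammer (3 / 2) n * fact n :: 'a :: field_char_0)"
proof -
  have "pochhammer (3 / 2 :: 'a) n = 2 * pochhammer (1 / 2) (Suc n)"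
    by (simp add: pochhammer_rec)
  also have "\<dots> = (2 * of_nat n + 1) * pochhammer (1 / 2) n"
    by (simp add: pochhammer_rec' algebra_simps)
  finally show ?thesis
    using fact_double[of n, where ?'a = 'a] by simp
qed

text \<open>Since \<open>(-1)^r (-n)_r = n! / (n - r)!\<close> for \<open>r \<le> n\<close>, the
  sums of the theorem are convolutions in disguise.\<close>

lemma sum_pochhammer_minus_of_nat:
  fixes f g :: "nat \<Rightarrow> 'a :: field_char_0"
  assumes "\<And>r. r > m \<Longrightarrow> f r = 0"
  shows "(\<Sum>r=0..m. (-1) ^ r * f r * pochhammer (- of_nat n) r * g (n - r)) =
    fact n * (\<Sum>r\<le>n. f r * (g (n - r) / fact (n - r)))"
proof -
  have "(\<Sum>r=0..m. (-1) ^ r * f r * pochhammer (- of_nat n) r * g (n - r)) =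
      (\<Sum>r\<le>max m n. (-1) ^ r * f r * pochhammer (- of_nat n) r * g (n - r))"
    by (rule sum.mono_neutral_left) (auto simp: assms)
  \<comment> \<open>Beyond \<open>n\<close> the truncated difference \<open>n - r\<close> is 0, but
    this is harmless because \<open>(-n)_r\<close> vanishes there.\<close>
  also have "\<dots> = (\<Sum>r\<le>n. (-1) ^ r * f r * pochhammer (- of_nat n) r * g (n - r))"
    by (rule sum.mono_neutral_right) (auto simp: pochhammer_of_nat_eq_0_lemma)
  also have "\<dots> = (\<Sum>r\<le>n. fact n * (f r * (g (n - r) / fact (n - r))))"
    by (rule sum.cong) (auto simp: pochhammer_minus_of_nat binomial_fact field_simps
        simp flip: power_mult_distrib)
  finally show ?thesis by (simp add: sum_distrib_left)
qed

text \<open>As \<open>G\<close> is a series in \<open>t^2\<close>, an odd index in \<open>F\<close>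
  would be paired with an odd index in \<open>G\<close>.\<close>

lemma fps_mult_nth_even:
  fixes F G :: "'a :: semiring_0 fps"
  assumes "\<And>m. fps_nth G (2 * m + 1) = 0"
  shows "fps_nth (F * G) (2 * n) = (\<Sum>r\<le>n. fps_nth F (2 * r) * fps_nth G (2 * (n - r)))"
proof -
  have "fps_nth (F * G) (2 * n) = (\<Sum>i\<in>(\<lambda>r. 2 * r) ` {..n}. fps_nth F i * fps_nth G (2 * n - i))"
    unfolding fps_mult_nth
  proof (rule sum.mono_neutral_right)
    show "\<forall>i\<in>{0..2 * n} - (\<lambda>r. 2 * r) ` {..n}. fps_nth F i * fps_nth G (2 * n - i) = 0"
    proof
      fix i assume i: "i \<in> {0..2 * n} - (\<lambda>r. 2 * r) ` {..n}"
      have "odd i"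
      proof
        assume "even i"
        then obtain r where "i = 2 * r" by blast
        with i show False by auto
      qed
      then obtain r where "i = 2 * r + 1" by (rule oddE)
      \<comment> \<open>An odd \<open>i\<close> is strictly below \<open>2 * n\<close>, so
        \<open>n - r - 1\<close> is not truncated.\<close>
      with i have "2 * n - i = 2 * (n - r - 1) + 1" by auto
      then show "fps_nth F i * fps_nth G (2 * n - i) = 0" by (simp only: assms mult_zero_right)
    qed
  qed auto
  also have "\<dots> = (\<Sum>r\<le>n. fps_nth F (2 * r) * fps_nth G (2 * (n - r)))"
    by (subst sum.reindex) (auto simp: inj_on_def diff_mult_distrib2)
  finally show ?thesis .
qed

lemma fps_mult_nth_odd:
  fixes F G :: "'a :: semiring_0 fps"
  assumes "\<And>m. fps_nth G (2 * m + 1) = 0"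
  shows "fps_nth (F * G) (2 * n + 1) = (\<Sum>r\<le>n. fps_nth F (2 * r + 1) * fps_nth G (2 * (n - r)))"
proof -
  have "fps_nth (F * G) (2 * n + 1) =
      (\<Sum>i\<in>(\<lambda>r. 2 * r + 1) ` {..n}. fps_nth F i * fps_nth G (2 * n + 1 - i))"
    unfolding fps_mult_nth
  proof (rule sum.mono_neutral_right)
    show "\<forall>i\<in>{0..2 * n + 1} - (\<lambda>r. 2 * r + 1) ` {..n}. fps_nth F i * fps_nth G (2 * n + 1 - i) = 0"
    proof
      fix i assume i: "i \<in> {0..2 * n + 1} - (\<lambda>r. 2 * r + 1) ` {..n}"
      have "even i"
      proof (rule ccontr)
        assume "odd i"
        then obtain r where "i = 2 * r + 1" by (rule oddE)
        with i show False by auto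
      qed
      then obtain r where "i = 2 * r" by blast
      with i have "2 * n + 1 - i = 2 * (n - r) + 1" by auto
      then show "fps_nth F i * fps_nth G (2 * n + 1 - i) = 0" by (simp only: assms mult_zero_right)
    qed
  qed auto
  also have "\<dots> = (\<Sum>r\<le>n. fps_nth F (2 * r + 1) * fps_nth G (2 * (n - r)))"
    by (subst sum.reindex) (auto simp: inj_on_def diff_mult_distrib2)
  finally show ?thesis .
qed

section \<open>Even and odd coefficients of
  \<open>(1 + s t)^j (1 - t^2)^(-(a + \<delta>))\<close>\<close>

theorem theorem1:
  fixes n j :: nat and a s \<delta> :: complex
  assumes "n > 0"
    and "(s = 1 \<and> \<delta> = of_nat j) \<or> (s = -1 \<and> \<delta> = 0)"
  shows
    "(pochhammer (2 * a + s * of_nat j) (2 * n) \<noteq> 0 \<longrightarrow>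
        hyp2F1_term (2 * n) a (2 * a + s * of_nat j) 2 =
          2 ^ (2 * n) * pochhammer (1 / 2) n / pochhammer (2 * a + s * of_nat j) (2 * n) *
          (\<Sum>r=0..j div 2. (-1) ^ r * of_nat (j choose (2 * r)) *
              pochhammer (- of_nat n) r * pochhammer (a + \<delta>) (n - r))) \<and>
     (pochhammer (2 * a + s * of_nat j) (2 * n + 1) \<noteq> 0 \<longrightarrow>
        hyp2F1_term (2 * n + 1) a (2 * a + s * of_nat j) 2 =
          s * (2 ^ (2 * n) * pochhammer (3 / 2) n / pochhammer (2 * a + s * of_nat j) (2 * n + 1)) *
          (\<Sum>r=0..j div 2. (-1) ^ r * of_nat (j choose (2 * r + 1)) *
              pochhammer (- of_nat n) r * pochhammer (a + \<delta>) (n - r)))"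
proof -
  define c where "c = 2 * a + s * of_nat j"
  define A where "A = (1 + fps_const s * fps_X) ^ j"
  define B where "B = fps_pochhammer (a + \<delta>) 1 * fps_pochhammer (a + \<delta>) (-1)"
  have nth_A: "fps_nth A k = of_nat (j choose k) * s ^ k" for k
    unfolding A_def by (rule fps_nth_one_plus_const_mult_X_power)
  have B_odd: "fps_nth B (2 * m + 1) = 0" for m
    unfolding B_def by (rule fps_pochhammer_one_mult_minus_one)
  have B_even: "fps_nth B (2 * m) = pochhammer (a + \<delta>) m / fact m" for m
    unfolding B_def by (rule fps_pochhammer_one_mult_minus_one)
  have gf: "fps_pochhammer (c - a) 1 * fps_pochhammer a (1 - 2) = A * B"
    using assms(2)
  proof
    \<comment> \<open>Here \<open>c - a = a + j\<close> already matches \<open>B\<close>; it remains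
      to write \<open>(1 + t)^(-a)\<close> as \<open>(1 + t)^j (1 + t)^(-(a + j))\<close>.\<close>
    assume s: "s = 1 \<and> \<delta> = of_nat j"
    show ?thesis
      using fps_pochhammer_shift_power[of "-1" j a] s
      by (simp add: c_def A_def B_def mult_ac flip: fps_const_neg)
  next
    \<comment> \<open>Now \<open>(1 + t)^(-a)\<close> matches \<open>B\<close>, and the factor to
      rewrite is \<open>(1 - t)^(-(a - j)) = (1 - t)^j (1 - t)^(-a)\<close>.\<close>
    assume s: "s = -1 \<and> \<delta> = 0"
    show ?thesis
      using fps_pochhammer_shift_power[of 1 j "a - of_nat j"] s
      by (simp add: c_def A_def B_def mult_ac flip: fps_const_neg)
  qed
  have hyp: "hyp2F1_term N a c 2 = fact N * fps_nth (A * B) N / pochhammer c N"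
    if "pochhammer c N \<noteq> 0" for N
    using pochhammer_mult_hyp2F1_term_eq_nth[OF that, of a 2] that
    unfolding gf by (simp add: field_simps)
  have s2: "s ^ (2 * r) = 1" for r
    using assms(2) by (auto simp: power_mult)
  \<comment> \<open>The cutoff condition holds because \<open>r > j div 2\<close> gives
    \<open>2 * r > j\<close>.\<close>
  have even: "(\<Sum>r=0..j div 2. (-1) ^ r * of_nat (j choose (2 * r)) * pochhammer (- of_nat n) r *
      pochhammer (a + \<delta>) (n - r)) = fact n * fps_nth (A * B) (2 * n)"
    by (subst sum_pochhammer_minus_of_nat)
      (auto simp: fps_mult_nth_even[OF B_odd] nth_A B_even s2 intro!: binomial_eq_0)
  \<comment> \<open>The odd coefficients of \<open>A\<close> carry \<open>s^(2r + 1) = s\<close>;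
    this is the sign in front of the second formula.\<close>
  have odd: "s * (\<Sum>r=0..j div 2. (-1) ^ r * of_nat (j choose (2 * r + 1)) *
      pochhammer (- of_nat n) r * pochhammer (a + \<delta>) (n - r)) =
      fact n * fps_nth (A * B) (2 * n + 1)"
    unfolding fps_mult_nth_odd[OF B_odd] nth_A B_even power_add s2
    by (subst sum_pochhammer_minus_of_nat)
      (auto simp: sum_distrib_left mult_ac intro!: binomial_eq_0 sum.cong)
  show ?thesis
    unfolding c_def[symmetric]
  proof (intro conjI impI)
    assume c: "pochhammer c (2 * n) \<noteq> 0"
    show "hyp2F1_term (2 * n) a c 2 = 2 ^ (2 * n) * pochhammer (1 / 2) n / pochhammer c (2 * n) *
        (\<Sum>r=0..j div 2. (-1) ^ r * of_nat (j choose (2 * r)) * pochhammer (- of_nat n) r *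
          pochhammer (a + \<delta>) (n - r))"
      unfolding even hyp[OF c] fact_double by simp
  next
    assume c: "pochhammer c (2 * n + 1) \<noteq> 0"
    have "hyp2F1_term (2 * n + 1) a c 2 =
        2 ^ (2 * n) * pochhammer (3 / 2) n / pochhammer c (2 * n + 1) *
        (fact n * fps_nth (A * B) (2 * n + 1))"
      unfolding hyp[OF c] fact_double_plus_one by simp
    then show "hyp2F1_term (2 * n + 1) a c 2 =
        s * (2 ^ (2 * n) * pochhammer (3 / 2) n / pochhammer c (2 * n + 1)) *
        (\<Sum>r=0..j div 2. (-1) ^ r * of_nat (j choose (2 * r + 1)) * pochhammer (- of_nat n) r *
          pochhammer (a + \<delta>) (n - r))"
      unfolding odd[symmetric] by (simp add: mult_ac)
  qed
qed

end
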